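(* Each $V\in\mathcal F$ is attracted by the renormalization operator $\mathcal R$ to the fixed point $V^*$; that is, $\mathcal R(V^* )=V^*$, and for every $V\in\mathcal F$, $$\lim_{n\to\infty}\mathcal R^n(V)(z)=V^*(z),\qquad\text{where } V^*(z)=\log\frac{j\,(k+1)}{(j-1)\,k}\ \text{ for each } z\in M_j|M_k.$$
   Context: $\hat\Sigma=\{0,1\}^{\mathbb Z}$; its points are written $\langle y|x\rangle=\langle\ldots y_2,y_1\,|\,x_0,x_1,x_2,\ldots\rangle$, where $x=(x_0,x_1,\ldots)$ is the future and $y=(y_1,y_2,\ldots)$ is the past. For $n\ge1$, $M_n\subset\{0,1\}^{\mathbb N}$ is the cylinder of one-sided sequences beginning with exactly $n$ zeros followed by a $1$, and $M_m|M_n=\{\langle y|x\rangle: x\in M_n,\ y\in M_m\}$. The set $\mathcal F$ consists of the non-negative continuous functions $V:\hat\Sigma\to\mathbb R$ which are constant on the sets $M_m|M_n$, for each pair $m,n\ge1$, and whose value $a_{m,n}=V(m,n)$ on $M_m|M_n$ satisfies $$a_{m,n}=\frac{m+n}{(m-1)\,n}+O\Big(\frac1{m^{1+\varepsilon_1}}\Big)+O\Big(\frac1{n^{1+\varepsilon_2}}\Big)$$ for some positive $\varepsilon_1,\varepsilon_2$. The renormalization operator $\mathcal R$ is defined as follows: for $z\in M_\zeta|M_{c_1}$ (so that $z$ has a block of $\zeta$ zeros immediately to the left of the bar and a block of $c_1$ zeros immediately to its right), $\mathcal R(V)(z)$ is the sum of the values of $V$ at the two points obtained from $z$ by replacing these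 two blocks by blocks of zeros of lengths $(2\zeta-1,\,2c_1+1)$ and $(2\zeta,\,2c_1)$ respectively, leaving the rest of $z$ unchanged; in short, $$\mathcal R(V)(z)=V(2\zeta-1,\,2c_1+1)+V(2\zeta,\,2c_1).$$ $\mathcal R^n$ denotes the $n$-th iterate of $\mathcal R$. *)

theory Defs
  imports "HOL-Analysis.Analysis" "HOL-Library.Landau_Symbols" "HOL-Library.FuncSet"
begin

text \<open>The two-sided shift space, with \<open>False\<close> for the symbol 0 and \<open>True\<close> for the symbol 1;
  \<open>continuous_on UNIV\<close> refers to the product topology on it.\<close>

type_synonym point = "int \<Rightarrow> bool"

definition future :: "point \<Rightarrow> nat \<Rightarrow> bool" where
  "future z i = z (int i)"

text \<open>The past \<open>(y\<^sub>1, y\<^sub>2, \<dots>)\<close> is read away from the bar; position \<open>i\<close> holds \<open>y\<^sub>i\<^sub>+\<^sub>1\<close>, so that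
  pasts and futures are sequences of the same kind.\<close>

definition past :: "point \<Rightarrow> nat \<Rightarrow> bool" where
  "past z i = z (- 1 - int i)"

text \<open>The point with past \<open>y\<close> and future \<open>x\<close>.\<close>

definition bar :: "(nat \<Rightarrow> bool) \<Rightarrow> (nat \<Rightarrow> bool) \<Rightarrow> point" where
  "bar y x = (\<lambda>i. if i \<ge> 0 then x (nat i) else y (nat (- 1 - i)))"

definition M :: "nat \<Rightarrow> (nat \<Rightarrow> bool) set" where
  "M n = {x. (\<forall>i<n. \<not> x i) \<and> x n}"

definition MM :: "nat \<Rightarrow> nat \<Rightarrow> point set" where
  "MM m n = {z. future z \<in> M n \<and> past z \<in> M m}"

definition blocks :: "point set" where
  "blocks = (\<Union>m\<in>{1..}. \<Union>n\<in>{1..}. MM m n)"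

text \<open>The number of leading zeros; only meaningful if \<open>x\<close> contains a 1.\<close>

definition zeros :: "(nat \<Rightarrow> bool) \<Rightarrow> nat" where
  "zeros x = (LEAST n. x n)"

text \<open>Replace the leading block of zeros by a block of \<open>n\<close> zeros, moving the remainder along.\<close>

definition reblock :: "nat \<Rightarrow> (nat \<Rightarrow> bool) \<Rightarrow> (nat \<Rightarrow> bool)" where
  "reblock n x = (\<lambda>i. if i < n then False else x (zeros x + (i - n)))"

text \<open>The big-O terms are taken as \<open>m\<close> and \<open>n\<close> both tend to infinity.  A continuous \<open>V\<close> is
  bounded, the shift space being compact, so this is equivalent to uniform bounds
  for all \<open>m \<ge> 2\<close> and \<open>n \<ge> 1\<close>.  For \<open>m = 1\<close> the leading term \<open>(m + n) / ((m - 1) n)\<close> is infinite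
  and a real value cannot obey the expansion, so none is required.\<close>

definition potentials :: "(point \<Rightarrow> real) set" where
  "potentials = {V. continuous_on UNIV V \<and> (\<forall>z. V z \<ge> 0) \<and>
     (\<exists>a :: nat \<Rightarrow> nat \<Rightarrow> real.
       (\<forall>m\<ge>1. \<forall>n\<ge>1. \<forall>z\<in>MM m n. V z = a m n) \<and>
       (\<exists>\<epsilon>\<^sub>1>0. \<exists>\<epsilon>\<^sub>2>0.
         \<exists>r \<in> O[at_top \<times>\<^sub>F at_top](\<lambda>(m, n). 1 / real m powr (1 + \<epsilon>\<^sub>1)).
         \<exists>s \<in> O[at_top \<times>\<^sub>F at_top](\<lambda>(m, n). 1 / real n powr (1 + \<epsilon>\<^sub>2)).
           \<forall>m\<ge>2. \<forall>n\<ge>1. a m n =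
             (real m + real n) / ((real m - 1) * real n) + r (m, n) + s (m, n)))}"

text \<open>The operator takes functions on \<open>blocks\<close> to functions on \<open>blocks\<close>; outside, the result has
  the junk value \<open>undefined\<close>.  It is polymorphic so as to apply to the real-valued potentials
  as well as to the extended-real-valued fixed point.\<close>

definition renorm :: "(point \<Rightarrow> 'b::plus) \<Rightarrow> point \<Rightarrow> 'b" where
  "renorm V = (\<lambda>z\<in>blocks. let \<zeta> = zeros (past z); c = zeros (future z) in
     V (bar (reblock (2 * \<zeta> - 1) (past z)) (reblock (2 * c + 1) (future z))) +
     V (bar (reblock (2 * \<zeta>) (past z)) (reblock (2 * c) (future z))))"

text \<open>For \<open>j = 1\<close> the logarithm of \<open>j (k + 1) / ((j - 1) k)\<close> is read as \<open>\<infinity>\<close>.\<close>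

definition Vstar :: "point \<Rightarrow> ereal" where
  "Vstar = (\<lambda>z\<in>blocks. let j = zeros (past z); k = zeros (future z) in
     if j = 1 then \<infinity>
     else ereal (ln (real j * (real k + 1) / ((real j - 1) * real k))))"

lemma zeros_eq: "x \<in> M n \<Longrightarrow> zeros x = n"
  unfolding M_def zeros_def by (auto intro!: Least_equality simp: not_less[symmetric])

lemma reblock_in_M: "x \<in> M k \<Longrightarrow> reblock n x \<in> M n"
  using zeros_eq[of x k] by (auto simp: M_def reblock_def)

lemma past_bar [simp]: "past (bar y x) = y"
  by (auto simp: past_def bar_def fun_eq_iff)

lemma future_bar [simp]: "future (bar y x) = x"
  by (auto simp: future_def bar_def fun_eq_iff)

lemma renorm_block_constant:
  assumes V: "\<And>m n z. m \<ge> 1 \<Longrightarrow> n \<ge> 1 \<Longrightarrow> z \<in> MM m n \<Longrightarrow> V z = a m n"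
    and z: "z \<in> MM j k" "j \<ge> 1" "k \<ge> 1"
  shows "renorm V z = a (2 * j - 1) (2 * k + 1) + a (2 * j) (2 * k)"
proof -
  have *: "past z \<in> M j" "future z \<in> M k" using z by (auto simp: MM_def)
  have "z \<in> blocks" using z by (auto simp: blocks_def)
  moreover have "bar (reblock m (past z)) (reblock n (future z)) \<in> MM m n" for m n
    using * by (auto simp: MM_def intro: reblock_in_M)
  ultimately show ?thesis
    using z * by (auto simp: renorm_def Let_def zeros_eq intro!: arg_cong2[where f = "(+)"] V)
qed

lemma Vstar_eq:
  assumes "z \<in> MM j k" "j \<ge> 1" "k \<ge> 1"
  shows "Vstar z = (if j = 1 then \<infinity>
    else ereal (ln (real j * (real k + 1) / ((real j - 1) * real k))))"
proof -
  have "z \<in> blocks" using assms by (auto simp: blocks_def)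
  moreover have "past z \<in> M j" "future z \<in> M k" using assms by (auto simp: MM_def)
  ultimately show ?thesis by (simp add: Vstar_def zeros_eq)
qed

end

theory Submission
  imports Defs "HOL-Real_Asymp.Real_Asymp"
begin

text \<open>
  On block-constant potentials the operator acts on the coefficients by
  \<open>a (j, k) \<mapsto> a (2j - 1, 2k + 1) + a (2j, 2k)\<close>.  Its \<open>p\<close>-th iterate at \<open>(j, k)\<close> is the sum of \<open>a\<close>
  over the \<open>2\<^sup>p\<close> points \<open>(2\<^sup>p j - i, 2\<^sup>p k + i)\<close>, \<open>i < 2\<^sup>p\<close>, of an antidiagonal segment
  (\<open>renorm_coeff_funpow\<close>).

  Let \<open>v (m, n) = ln (m (n + 1) / ((m - 1) n))\<close>.  For \<open>j \<ge> 2\<close> the logarithms telescope and \<open>v\<close> is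
  fixed by the operator.  There is then no Riemann sum to evaluate: the distance of the
  \<open>p\<close>-th iterate of \<open>a\<close> from \<open>v\<close> is at most the sum of \<open>\<bar>a - v\<bar>\<close> over the segment.  Since
  \<open>(m + n) / ((m - 1) n)\<close> agrees with \<open>v (m, n) = ln (1 + 1 / (m - 1)) + ln (1 + 1 / n)\<close> up to
  second-order terms in \<open>1 / (m - 1)\<close> and \<open>1 / n\<close>, and both coordinates are at least \<open>2\<^sup>p\<close> on the
  segment, each of the \<open>2\<^sup>p\<close> summands is \<open>O((2\<^sup>p) powr - (1 + \<epsilon>))\<close> for some \<open>\<epsilon> > 0\<close>, and the sum
  tends to 0 (\<open>renorm_coeff_tendsto\<close>).

  For \<open>j = 1\<close> the segment reaches down to \<open>m = 1\<close>, where only the sign of \<open>a\<close> is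
  under control.  One step of the recursion turns \<open>(1, k)\<close> into \<open>(1, 2k + 1)\<close> and \<open>(2, 2k)\<close>; by the first
  case the second point contributes more than \<open>ln 2\<close> in the long run.  Repeating this on the first
  point as often as desired gives arbitrarily large lower bounds (\<open>renorm_coeff_unbounded\<close>).
\<close>

section \<open>The operator on block coefficients\<close>

definition renorm_coeff :: "(nat \<Rightarrow> nat \<Rightarrow> real) \<Rightarrow> nat \<Rightarrow> nat \<Rightarrow> real" where
  "renorm_coeff a j k = a (2 * j - 1) (2 * k + 1) + a (2 * j) (2 * k)"

lemma blocksE:
  assumes "z \<in> blocks"
  obtains j k where "j \<ge> 1" "k \<ge> 1" "z \<in> MM j k"
  using assms by (auto simp: blocks_def)

lemma MM_nonempty: "\<exists>z. z \<in> MM m n"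
proof
  show "bar (\<lambda>i. i = m) (\<lambda>i. i = n) \<in> MM m n"
    by (auto simp: MM_def M_def)
qed

lemma renorm_funpow_block:
  assumes V: "\<And>m n z. m \<ge> 1 \<Longrightarrow> n \<ge> 1 \<Longrightarrow> z \<in> MM m n \<Longrightarrow> V z = a m n"
    and "z \<in> MM j k" "j \<ge> 1" "k \<ge> 1"
  shows "(renorm ^^ p) V z = (renorm_coeff ^^ p) a j k"
  using assms(2-)
proof (induction p arbitrary: z j k)
  case 0
  then show ?case by (simp add: V)
next
  case (Suc p)
  have "renorm ((renorm ^^ p) V) z
      = (renorm_coeff ^^ p) a (2 * j - 1) (2 * k + 1) + (renorm_coeff ^^ p) a (2 * j) (2 * k)"
    using Suc by (intro renorm_block_constant) auto
  then show ?case by (simp add: renorm_coeff_def[of _ j k])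
qed

text \<open>Applying the operator once more splits the index \<open>i\<close> of the segment into the indices \<open>2i\<close>
  and \<open>2i + 1\<close>, so that no point is met twice.\<close>

lemma renorm_coeff_funpow:
  assumes "j \<ge> 1"
  shows "(renorm_coeff ^^ p) a j k = (\<Sum>i<2^p. a (2^p * j - i) (2^p * k + i))"
proof (induction p arbitrary: a)
  case 0
  then show ?case by simp
next
  case (Suc p)
  have split: "(\<Sum>i<2 * N. f i) = (\<Sum>i<N. f (2 * i + 1) + f (2 * i))" for f :: "nat \<Rightarrow> real" and N
    by (induction N) (auto simp: algebra_simps)
  have "(renorm_coeff ^^ Suc p) a j k = (renorm_coeff ^^ p) (renorm_coeff a) j k"
    by (simp add: funpow_swap1)
  also have "\<dots> = (\<Sum>i<2^p. renorm_coeff a (2^p * j - i) (2^p * k + i))"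
    by (rule Suc)
  also have "\<dots> = (\<Sum>i<2^p. a (2^Suc p * j - (2 * i + 1)) (2^Suc p * k + (2 * i + 1))
                         + a (2^Suc p * j - 2 * i) (2^Suc p * k + 2 * i))"
    by (intro sum.cong refl) (simp add: renorm_coeff_def algebra_simps diff_mult_distrib2)
  also have "\<dots> = (\<Sum>i<2^Suc p. a (2^Suc p * j - i) (2^Suc p * k + i))"
    using split[of "\<lambda>i. a (2^Suc p * j - i) (2^Suc p * k + i)" "2^p"] by simp
  finally show ?case .
qed

lemma renorm_coeff_funpow_nonneg:
  assumes a: "\<And>m n. m \<ge> 1 \<Longrightarrow> n \<ge> 1 \<Longrightarrow> a m n \<ge> 0" and "j \<ge> 1" "k \<ge> 1"
  shows "(renorm_coeff ^^ p) a j k \<ge> 0"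
  using assms(2-)
proof (induction p arbitrary: j k)
  case 0
  then show ?case by (simp add: a)
next
  case (Suc p)
  then show ?case by (auto simp: renorm_coeff_def intro!: add_nonneg_nonneg)
qed

section \<open>The fixed point\<close>

definition vstar :: "nat \<Rightarrow> nat \<Rightarrow> real" where
  "vstar j k = ln (real j * (real k + 1) / ((real j - 1) * real k))"

lemma vstar_renorm_coeff:
  assumes "j \<ge> 2" "k \<ge> 1"
  shows "renorm_coeff vstar j k = vstar j k"
proof -
  define x where "x = real j"
  define y where "y = real k"
  have x: "x \<ge> 2" and y: "y \<ge> 1"
    using assms by (auto simp: x_def y_def)
  have "renorm_coeff vstar j k
      = ln ((2*x - 1) * (2*y + 2) / ((2*x - 2) * (2*y + 1)))
        + ln ((2*x) * (2*y + 1) / ((2*x - 1) * (2*y)))"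
    using assms by (simp add: renorm_coeff_def vstar_def x_def y_def of_nat_diff add_ac)
  also have "\<dots> = ln (((2*x - 1) * (2*y + 2) / ((2*x - 2) * (2*y + 1)))
        * ((2*x) * (2*y + 1) / ((2*x - 1) * (2*y))))"
    using x y by (subst ln_mult_pos) auto
  also have "((2*x - 1) * (2*y + 2) / ((2*x - 2) * (2*y + 1)))
        * ((2*x) * (2*y + 1) / ((2*x - 1) * (2*y))) = x * (y + 1) / ((x - 1) * y)"
  proof -
    have cancel: "(u * (2 * s) / ((2 * t) * w)) * ((2 * x) * w / (u * (2 * y))) = x * s / (t * y)"
      if "u \<noteq> 0" "w \<noteq> 0" for u s t w :: real
      using that by (simp add: field_simps)
    show ?thesis
      using cancel[of "2*x - 1" "2*y + 1" "y + 1" "x - 1"] x y by (simp add: algebra_simps)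
  qed
  finally show ?thesis by (simp add: vstar_def[of j k] x_def y_def)
qed

lemma vstar_renorm_coeff_funpow:
  assumes "j \<ge> 2" "k \<ge> 1"
  shows "(renorm_coeff ^^ p) vstar j k = vstar j k"
  using assms
proof (induction p arbitrary: j k)
  case 0
  then show ?case by simp
next
  case (Suc p)
  have "(renorm_coeff ^^ Suc p) vstar j k = renorm_coeff vstar j k"
    using Suc by (simp add: renorm_coeff_def[of _ j k])
  then show ?case using Suc.prems by (simp add: vstar_renorm_coeff)
qed

lemma Vstar_eq_vstar:
  assumes "z \<in> MM j k" "j \<ge> 1" "k \<ge> 1"
  shows "Vstar z = (if j = 1 then \<infinity> else ereal (vstar j k))"
  using Vstar_eq[OF assms] by (simp add: vstar_def)

text \<open>On the singular line \<open>j = 1\<close> the summand at \<open>(1, 2k + 1)\<close> is again on that line, hence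
  infinite, and absorbs the finite summand at \<open>(2, 2k)\<close>.\<close>

lemma renorm_Vstar: "renorm Vstar = Vstar"
proof
  fix z
  show "renorm Vstar z = Vstar z"
  proof (cases "z \<in> blocks")
    case False
    then show ?thesis by (simp add: renorm_def Vstar_def)
  next
    case True
    then obtain j k where z: "j \<ge> 1" "k \<ge> 1" "z \<in> MM j k" by (rule blocksE)
    define b where "b = (\<lambda>j k. if j = 1 then \<infinity> else ereal (vstar j k))"
    have "renorm Vstar z = b (2 * j - 1) (2 * k + 1) + b (2 * j) (2 * k)"
      using z by (intro renorm_block_constant) (auto simp: Vstar_eq_vstar b_def)
    also have "\<dots> = b j k"
      using vstar_renorm_coeff[of j k] z by (auto simp: b_def renorm_coeff_def)
    also have "\<dots> = Vstar z"
      using z by (simp add: Vstar_eq_vstar b_def)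
    finally show ?thesis .
  qed
qed

section \<open>Convergence off the singular line\<close>

text \<open>Writing \<open>u = 1 / (m - 1)\<close> and \<open>w = 1 / n\<close>, the rational expression is \<open>u + w + u w\<close> and
  \<open>vstar m n\<close> is \<open>ln (1 + u) + ln (1 + w)\<close>.\<close>

lemma vstar_approx:
  assumes "m > N" "n \<ge> N" "N \<ge> 1"
  shows "\<bar>(real m + real n) / ((real m - 1) * real n) - vstar m n\<bar> \<le> 3 / (real N)\<^sup>2"
proof -
  define u where "u = 1 / (real m - 1)"
  define w where "w = 1 / real n"
  define e where "e = 1 / real N"
  have pos: "real m - 1 \<ge> real N" "real n \<ge> real N" "real N \<ge> 1"
    using assms by auto
  have e: "e \<le> 1" using pos by (simp add: e_def)
  have u: "0 \<le> u" "u \<le> e" unfolding u_def e_def using pos by (auto intro!: frac_le)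
  have w: "0 \<le> w" "w \<le> e" unfolding w_def e_def using pos by (auto intro!: frac_le)
  have "real m * (real n + 1) / ((real m - 1) * real n) = (1 + u) * (1 + w)"
    unfolding u_def w_def using pos by (simp add: field_simps)
  then have v: "vstar m n = ln (1 + u) + ln (1 + w)"
    unfolding vstar_def using u w by (simp add: ln_mult_pos)
  have rat: "(real m + real n) / ((real m - 1) * real n) = u + w + u * w"
    unfolding u_def w_def using pos by (simp add: field_simps)
  have "\<bar>ln (1 + u) - u\<bar> \<le> u\<^sup>2" "\<bar>ln (1 + w) - w\<bar> \<le> w\<^sup>2"
    using u w e by (auto intro!: abs_ln_one_plus_x_minus_x_bound_nonneg)
  moreover have "u\<^sup>2 \<le> e\<^sup>2" "w\<^sup>2 \<le> e\<^sup>2" "u * w \<le> e\<^sup>2" "0 \<le> u * w"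
    using u w by (auto intro: power_mono simp: power2_eq_square mult_mono)
  ultimately have "\<bar>u + w + u * w - (ln (1 + u) + ln (1 + w))\<bar> \<le> 3 * e\<^sup>2"
    by linarith
  then show ?thesis by (simp add: v rat e_def power_divide)
qed

text \<open>The form in which the asymptotic expansion is used: one bound \<open>\<delta> N\<close> for the deviation
  on the whole quadrant \<open>m > N\<close>, \<open>n \<ge> N\<close>, small enough to be added up \<open>N\<close> times.\<close>

lemma potentials_coeff:
  assumes "V \<in> potentials"
  obtains a \<delta> L where
    "\<And>m n z. m \<ge> 1 \<Longrightarrow> n \<ge> 1 \<Longrightarrow> z \<in> MM m n \<Longrightarrow> V z = a m n"
    "\<And>m n. m \<ge> 1 \<Longrightarrow> n \<ge> 1 \<Longrightarrow> a m n \<ge> 0"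
    "\<And>N m n. N \<ge> L \<Longrightarrow> m > N \<Longrightarrow> n \<ge> N \<Longrightarrow> \<bar>a m n - vstar m n\<bar> \<le> \<delta> N"
    "(\<lambda>N. real N * \<delta> N) \<longlonglongrightarrow> 0"
proof -
  from assms obtain a r s and e1 e2 :: real where
    V0: "\<And>z. V z \<ge> 0" and
    a: "\<And>m n z. m \<ge> 1 \<Longrightarrow> n \<ge> 1 \<Longrightarrow> z \<in> MM m n \<Longrightarrow> V z = a m n" and
    e: "e1 > 0" "e2 > 0" and
    r: "r \<in> O[at_top \<times>\<^sub>F at_top](\<lambda>(m::nat, n::nat). 1 / real m powr (1 + e1))" and
    s: "s \<in> O[at_top \<times>\<^sub>F at_top](\<lambda>(m::nat, n::nat). 1 / real n powr (1 + e2))" and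
    exp: "\<And>m n. m \<ge> 2 \<Longrightarrow> n \<ge> 1 \<Longrightarrow>
      a m n = (real m + real n) / ((real m - 1) * real n) + r (m, n) + s (m, n)"
    unfolding potentials_def by blast
  have nonneg: "a m n \<ge> 0" if "m \<ge> 1" "n \<ge> 1" for m n
    using MM_nonempty[of m n] a[OF that] V0 by metis
  from r obtain C where C: "C > 0"
      "\<forall>\<^sub>F x in at_top \<times>\<^sub>F at_top. norm (r x) \<le> C * norm (case x of (m, n) \<Rightarrow> 1 / real m powr (1 + e1))"
    by (rule landau_o.bigE)
  from s obtain D where D: "D > 0"
      "\<forall>\<^sub>F x in at_top \<times>\<^sub>F at_top. norm (s x) \<le> D * norm (case x of (m, n) \<Rightarrow> 1 / real n powr (1 + e2))"
    by (rule landau_o.bigE)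
  from eventually_conj[OF C(2) D(2)] obtain K where K:
    "\<And>m n. m \<ge> K \<Longrightarrow> n \<ge> K \<Longrightarrow> \<bar>r (m, n)\<bar> \<le> C * (1 / real m powr (1 + e1)) \<and>
        \<bar>s (m, n)\<bar> \<le> D * (1 / real n powr (1 + e2))"
    by (auto simp: eventually_prod_sequentially)
  define \<delta> where "\<delta> = (\<lambda>N. 3 / (real N)\<^sup>2 + C * (1 / real N powr (1 + e1))
    + D * (1 / real N powr (1 + e2)))"
  have close: "\<bar>a m n - vstar m n\<bar> \<le> \<delta> N" if "N \<ge> max K 1" "m > N" "n \<ge> N" for N m n
  proof -
    have powr: "1 / real x powr (1 + \<epsilon>) \<le> 1 / real N powr (1 + \<epsilon>)" if "x \<ge> N" "\<epsilon> > 0" for x \<epsilon>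
      using that \<open>N \<ge> max K 1\<close> by (intro frac_le powr_mono2) auto
    have "\<bar>r (m, n)\<bar> \<le> C * (1 / real m powr (1 + e1))"
      "\<bar>s (m, n)\<bar> \<le> D * (1 / real n powr (1 + e2))"
      using K[of m n] that by auto
    moreover have "C * (1 / real m powr (1 + e1)) \<le> C * (1 / real N powr (1 + e1))"
      "D * (1 / real n powr (1 + e2)) \<le> D * (1 / real N powr (1 + e2))"
      using powr that e C(1) D(1) by (auto intro!: mult_left_mono simp del: times_divide_eq_right)
    moreover have "\<bar>(real m + real n) / ((real m - 1) * real n) - vstar m n\<bar> \<le> 3 / (real N)\<^sup>2"
      using that by (intro vstar_approx) auto
    moreover have "a m n = (real m + real n) / ((real m - 1) * real n) + r (m, n) + s (m, n)"
      using that by (intro exp) auto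
    ultimately show ?thesis unfolding \<delta>_def by linarith
  qed
  have "(\<lambda>N. real N * \<delta> N) \<longlonglongrightarrow> 0"
  proof -
    have "(\<lambda>N. real N * (3 / (real N)\<^sup>2)) \<longlonglongrightarrow> 0"
      by real_asymp
    moreover have "(\<lambda>N. real N * (E * (1 / real N powr (1 + \<epsilon>)))) \<longlonglongrightarrow> 0" if "\<epsilon> > 0" for E \<epsilon> :: real
    proof -
      have "(\<lambda>N. E * (real N * (1 / real N powr (1 + \<epsilon>)))) \<longlonglongrightarrow> E * 0"
        using that by (intro tendsto_mult_left) real_asymp
      then show ?thesis by (simp add: mult_ac)
    qed
    ultimately have "(\<lambda>N. real N * (3 / (real N)\<^sup>2) + real N * (C * (1 / real N powr (1 + e1)))
        + real N * (D * (1 / real N powr (1 + e2)))) \<longlonglongrightarrow> 0 + 0 + 0"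
      using e by (intro tendsto_add)
    then show ?thesis unfolding \<delta>_def by (simp only: distrib_left add_0)
  qed
  with a nonneg close show thesis by (rule that)
qed

text \<open>Both the iterate of \<open>a\<close> and the fixed value \<open>vstar j k\<close> are sums over the same segment, which for \<open>j \<ge> 2\<close> lies in the
  quadrant \<open>m > 2\<^sup>p\<close>, \<open>n \<ge> 2\<^sup>p\<close>: its smallest \<open>m\<close> is \<open>2\<^sup>p (j - 1) + 1\<close>.\<close>

lemma renorm_coeff_tendsto:
  assumes close: "\<And>N m n. N \<ge> L \<Longrightarrow> m > N \<Longrightarrow> n \<ge> N \<Longrightarrow> \<bar>a m n - vstar m n\<bar> \<le> \<delta> N"
    and \<delta>: "(\<lambda>N. real N * \<delta> N) \<longlonglongrightarrow> 0"
    and "j \<ge> 2" "k \<ge> 1"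
  shows "(\<lambda>p. (renorm_coeff ^^ p) a j k) \<longlonglongrightarrow> vstar j k"
proof -
  have powers: "filterlim (\<lambda>p::nat. 2 ^ p :: nat) at_top at_top"
    by (rule filterlim_subseq) (simp add: strict_mono_def)
  have bound: "\<bar>(renorm_coeff ^^ p) a j k - vstar j k\<bar> \<le> real (2^p) * \<delta> (2^p)" if "2^p \<ge> L" for p
  proof -
    have "vstar j k = (\<Sum>i<2^p. vstar (2^p * j - i) (2^p * k + i))"
      using vstar_renorm_coeff_funpow[OF assms(3,4), of p] assms(3)
      by (simp add: renorm_coeff_funpow)
    then have "(renorm_coeff ^^ p) a j k - vstar j k
        = (\<Sum>i<2^p. a (2^p * j - i) (2^p * k + i) - vstar (2^p * j - i) (2^p * k + i))"
      using assms(3) by (simp add: renorm_coeff_funpow sum_subtractf)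
    also have "\<bar>\<dots>\<bar> \<le> (\<Sum>i<(2::nat)^p. \<delta> (2^p))"
    proof (rule order_trans[OF sum_abs sum_mono])
      fix i :: nat
      assume i: "i \<in> {..<2^p}"
      have "(2::nat)^p * 2 \<le> 2^p * j" "(2::nat)^p * 1 \<le> 2^p * k"
        using assms(3,4) by (intro mult_left_mono; simp)+
      then have "2^p * j - i > 2^p" "2^p * k + i \<ge> 2^p"
        using i unfolding lessThan_iff by linarith+
      then show "\<bar>a (2^p * j - i) (2^p * k + i) - vstar (2^p * j - i) (2^p * k + i)\<bar> \<le> \<delta> (2^p)"
        using that by (intro close)
    qed
    finally show ?thesis by simp
  qed
  have "\<forall>\<^sub>F p in sequentially. L \<le> 2^p"
    using powers by (auto simp: filterlim_at_top)
  then have "\<forall>\<^sub>F p in sequentially.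
      norm ((renorm_coeff ^^ p) a j k - vstar j k) \<le> real (2^p) * \<delta> (2^p)"
    by eventually_elim (use bound in simp)
  moreover have "(\<lambda>p. real (2^p) * \<delta> (2^p)) \<longlonglongrightarrow> 0"
    using filterlim_compose[OF \<delta> powers] .
  ultimately have "(\<lambda>p. (renorm_coeff ^^ p) a j k - vstar j k) \<longlonglongrightarrow> 0"
    by (rule Lim_null_comparison)
  then show ?thesis by (simp add: LIM_zero_iff)
qed

section \<open>Divergence on the singular line\<close>

text \<open>Each further step of the recursion splits off a point \<open>(2, 2k)\<close> whose limit
  \<open>vstar 2 (2k) = ln (2 (2k + 1) / (2k))\<close> exceeds \<open>ln 2\<close>; the part that stays on the line
  \<open>j = 1\<close> is dealt with by the induction hypothesis, for a larger \<open>k\<close>.\<close>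

lemma renorm_coeff_unbounded:
  assumes nonneg: "\<And>m n. m \<ge> 1 \<Longrightarrow> n \<ge> 1 \<Longrightarrow> a m n \<ge> 0"
    and lim: "\<And>j k. j \<ge> 2 \<Longrightarrow> k \<ge> 1 \<Longrightarrow> (\<lambda>p. (renorm_coeff ^^ p) a j k) \<longlonglongrightarrow> vstar j k"
    and "k \<ge> 1"
  shows "\<forall>\<^sub>F p in sequentially. (renorm_coeff ^^ p) a 1 k \<ge> real q * ln 2"
  using assms(3)
proof (induction q arbitrary: k)
  case 0
  then show ?case using renorm_coeff_funpow_nonneg[OF nonneg] by simp
next
  case (Suc q)
  have "ln 2 < vstar 2 (2 * k)"
    using Suc.prems by (simp add: vstar_def field_simps)
  then have "\<forall>\<^sub>F p in sequentially. ln 2 < (renorm_coeff ^^ p) a 2 (2 * k)"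
    using order_tendstoD(1)[OF lim[of 2 "2 * k"]] Suc.prems by simp
  moreover have "\<forall>\<^sub>F p in sequentially. real q * ln 2 \<le> (renorm_coeff ^^ p) a 1 (2 * k + 1)"
    by (rule Suc.IH) simp
  ultimately have "\<forall>\<^sub>F p in sequentially. real (Suc q) * ln 2 \<le> (renorm_coeff ^^ Suc p) a 1 k"
    by eventually_elim (simp add: renorm_coeff_def[of _ "Suc 0" k] distrib_right)
  then show ?case by (subst (asm) eventually_sequentially_Suc)
qed

section \<open>Attraction to the fixed point\<close>

lemma renorm_funpow_tendsto_Vstar:
  assumes "V \<in> potentials" "z \<in> blocks"
  shows "(\<lambda>p. ereal ((renorm ^^ p) V z)) \<longlonglongrightarrow> Vstar z"
proof -
  obtain a \<delta> L where a: "\<And>m n z. m \<ge> 1 \<Longrightarrow> n \<ge> 1 \<Longrightarrow> z \<in> MM m n \<Longrightarrow> V z = a m n"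
    and nonneg: "\<And>m n. m \<ge> 1 \<Longrightarrow> n \<ge> 1 \<Longrightarrow> a m n \<ge> 0"
    and close: "\<And>N m n. N \<ge> L \<Longrightarrow> m > N \<Longrightarrow> n \<ge> N \<Longrightarrow> \<bar>a m n - vstar m n\<bar> \<le> \<delta> N"
    and \<delta>: "(\<lambda>N. real N * \<delta> N) \<longlonglongrightarrow> 0"
    by (rule potentials_coeff[OF assms(1)]) blast
  from assms(2) obtain j k where z: "j \<ge> 1" "k \<ge> 1" "z \<in> MM j k" by (rule blocksE)
  have eq: "(renorm ^^ p) V z = (renorm_coeff ^^ p) a j k" for p
    by (rule renorm_funpow_block[OF a z(3,1,2)])
  have lim: "(\<lambda>p. (renorm_coeff ^^ p) a j k) \<longlonglongrightarrow> vstar j k" if "j \<ge> 2" "k \<ge> 1" for j k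
    using close \<delta> that by (rule renorm_coeff_tendsto)
  show ?thesis
  proof (cases "j = 1")
    case False
    then show ?thesis using lim[of j k] z by (simp add: eq Vstar_eq_vstar[of z j k])
  next
    case True
    have "\<forall>\<^sub>F p in sequentially. ereal B < ereal ((renorm_coeff ^^ p) a 1 k)" for B
    proof -
      obtain q where q: "B < real q * ln 2"
        using ex_less_of_nat_mult[of "ln 2" B] by auto
      show ?thesis
        using renorm_coeff_unbounded[OF nonneg lim \<open>k \<ge> 1\<close>, of q]
        by (auto elim!: eventually_mono intro: less_le_trans[OF q])
    qed
    then show ?thesis
      using True z by (simp add: eq Vstar_eq_vstar[of z j k] tendsto_PInfty)
  qed
qed

theorem theorem2p3:
  shows "renorm Vstar = Vstar \<and>
    (\<forall>V\<in>potentials. \<forall>z\<in>blocks. (\<lambda>n. ereal ((renorm ^^ n) V z)) \<longlonglongrightarrow> Vstar z)"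
  using renorm_Vstar renorm_funpow_tendsto_Vstar by blast

end
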